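(* Let $E$ be a row-finite graph without sinks and $(X,\sigma)$ the associated Deaconu-Renault system. Then $$h(\sigma)=\sup_{H\subseteq E}h(\sigma_H),$$ where the supremum is taken over all finite subgraphs $H$ of $E$, and $(X_H,\sigma_H)$ is the Deaconu-Renault system associated with the graph $H$.
   Context: $\mathbb N=\{1,2,\dots\}$. A graph is a quadruple $E=(E^0,E^1,r,s)$ with countable sets $E^0$ of vertices and $E^1$ of edges and maps $r,s:E^1\to E^0$ (range and source). It has no sinks if $s^{-1}(v)\neq\emptyset$ for all $v\in E^0$, and is row-finite if $|s^{-1}(v)|<\infty$ for all $v\in E^0$. A path of length $n$ is a sequence $e_1\dots e_n$ of edges with $s(e_{i+1})=r(e_i)$; infinite paths are defined similarly. The Deaconu-Renault system associated with a row-finite graph $E$ is $(X,\sigma)$, where $X$ is the set of all infinite paths in $E$ with the topology generated by the cylinder sets $C_\beta=\{x\in X: x \text{ has initial segment }\beta\}$, $\beta$ a finite path of length $\geq1$, and $\sigma:X\to X$ is the shift $\sigma(x_1x_2x_3\dots)=x_2x_3\dots$, with $Dom(\sigma)=X$. For a finite subgraph $H$, $X_H$ is the set of all infinite paths in $H$ (with the cylinder topology) and $\sigma_H$ is the shift on $X_H$. Topological entropy. For families $\alpha,\beta$ of subsets of $X$ let $\alpha\vee\beta=\{A\cap B:A\in\alpha,B\in\beta\}$ and $\sigma^{-i}(\alpha)=\{\sigma^{-i}(A):A\in\alpha\}$. For $Y\subseteq X$, a cover of $Y$ is a family of subsets of $X$ whose union contains $Y$; it is open if its members are open in $X$. For a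 cover $\alpha$ of $Y$ and $n\in\mathbb N$ let $\alpha_n=\alpha\vee\sigma^{-1}(\alpha)\vee\dots\vee\sigma^{-n}(\alpha)$, a cover of $Y_n=Y\cap\sigma^{-1}(Y)\cap\dots\cap\sigma^{-n}(Y)$. $N(\alpha,Y)$ is the smallest cardinality of a subfamily of $\alpha$ covering $Y$ (with $N=1$ when the set to be covered is empty), and $H(\alpha,Y)=\log N(\alpha,Y)$. For compact $K\subseteq X$ and an open cover $\alpha$ of $K$, $h(\alpha,\sigma,K)=\lim_{n\to\infty}\frac1nH(\alpha_n,K_n)$ (this limit exists); $h(\sigma,K)=\sup_\alpha h(\alpha,\sigma,K)$ over open covers $\alpha$ of $K$; $h(\sigma)=\sup_Kh(\sigma,K)$ over compact $K\subseteq X$. *)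

theory Defs
  imports "HOL-Analysis.Analysis" "Graph_Theory.Digraph_Component"
begin

section \<open>Topological entropy of a map on a possibly non-compact space\<close>

text \<open>Throughout, \<open>T\<close> is a topology on the set \<^term>\<open>topspace T\<close> and \<open>\<sigma>\<close> is a map with domain
  \<^term>\<open>topspace T\<close>; preimages are taken inside \<^term>\<open>topspace T\<close>.\<close>

definition iter_preimage :: "'a topology \<Rightarrow> ('a \<Rightarrow> 'a) \<Rightarrow> nat \<Rightarrow> 'a set \<Rightarrow> 'a set" where
  "iter_preimage T \<sigma> i A = {x \<in> topspace T. (\<sigma> ^^ i) x \<in> A}"

definition cover_join :: "'a set set \<Rightarrow> 'a set set \<Rightarrow> 'a set set" where
  "cover_join \<alpha> \<beta> = {A \<inter> B | A B. A \<in> \<alpha> \<and> B \<in> \<beta>}"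

primrec refined_cover :: "'a topology \<Rightarrow> ('a \<Rightarrow> 'a) \<Rightarrow> 'a set set \<Rightarrow> nat \<Rightarrow> 'a set set" where
  "refined_cover T \<sigma> \<alpha> 0 = \<alpha>"
| "refined_cover T \<sigma> \<alpha> (Suc n) =
     cover_join (refined_cover T \<sigma> \<alpha> n) (iter_preimage T \<sigma> (Suc n) ` \<alpha>)"

definition orbit_part :: "'a topology \<Rightarrow> ('a \<Rightarrow> 'a) \<Rightarrow> 'a set \<Rightarrow> nat \<Rightarrow> 'a set" where
  "orbit_part T \<sigma> Y n = (\<Inter>i\<le>n. iter_preimage T \<sigma> i Y)"

definition open_cover :: "'a topology \<Rightarrow> 'a set \<Rightarrow> 'a set set \<Rightarrow> bool" where
  "open_cover T Y \<alpha> \<longleftrightarrow> (\<forall>A \<in> \<alpha>. openin T A) \<and> Y \<subseteq> \<Union>\<alpha>"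

text \<open>The value is \<open>\<infinity>\<close> if no finite subfamily of \<open>\<alpha>\<close> covers \<open>Y\<close>.\<close>

definition cover_number :: "'a set set \<Rightarrow> 'a set \<Rightarrow> enat" where
  "cover_number \<alpha> Y =
     (if Y = {} then 1
      else (INF \<beta> \<in> {\<beta>. \<beta> \<subseteq> \<alpha> \<and> finite \<beta> \<and> Y \<subseteq> \<Union>\<beta>}. enat (card \<beta>)))"

definition cover_entropy :: "'a set set \<Rightarrow> 'a set \<Rightarrow> ereal" where
  "cover_entropy \<alpha> Y =
     (case cover_number \<alpha> Y of enat k \<Rightarrow> ereal (ln (real k)) | \<infinity> \<Rightarrow> \<infinity>)"

definition entropy_cover :: "'a topology \<Rightarrow> ('a \<Rightarrow> 'a) \<Rightarrow> 'a set \<Rightarrow> 'a set set \<Rightarrow> ereal" where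
  "entropy_cover T \<sigma> K \<alpha> =
     lim (\<lambda>n. cover_entropy (refined_cover T \<sigma> \<alpha> n) (orbit_part T \<sigma> K n) / ereal (real n))"

definition entropy_compact :: "'a topology \<Rightarrow> ('a \<Rightarrow> 'a) \<Rightarrow> 'a set \<Rightarrow> ereal" where
  "entropy_compact T \<sigma> K = (SUP \<alpha> \<in> {\<alpha>. open_cover T K \<alpha>}. entropy_cover T \<sigma> K \<alpha>)"

definition top_entropy :: "'a topology \<Rightarrow> ('a \<Rightarrow> 'a) \<Rightarrow> ereal" where
  "top_entropy T \<sigma> = (SUP K \<in> {K. compactin T K}. entropy_compact T \<sigma> K)"


section \<open>The Deaconu-Renault system of a graph\<close>

text \<open>The source and range maps of a graph are \<^const>\<open>tail\<close> and \<^const>\<open>head\<close>. Infinite paths are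
  indexed from 0.\<close>

definition infinite_paths :: "('v, 'e) pre_digraph \<Rightarrow> (nat \<Rightarrow> 'e) set" where
  "infinite_paths E = {x. \<forall>n. x n \<in> arcs E \<and> tail E (x (Suc n)) = head E (x n)}"

definition nonempty_paths :: "('v, 'e) pre_digraph \<Rightarrow> 'e list set" where
  "nonempty_paths E = {\<beta>. \<beta> \<noteq> [] \<and> (\<exists>u v. pre_digraph.awalk E u \<beta> v)}"

definition cylinder :: "('v, 'e) pre_digraph \<Rightarrow> 'e list \<Rightarrow> (nat \<Rightarrow> 'e) set" where
  "cylinder E \<beta> = {x \<in> infinite_paths E. \<forall>i < length \<beta>. x i = \<beta> ! i}"

definition path_space :: "('v, 'e) pre_digraph \<Rightarrow> (nat \<Rightarrow> 'e) topology" where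
  "path_space E = topology_generated_by (cylinder E ` nonempty_paths E)"

definition path_shift :: "(nat \<Rightarrow> 'e) \<Rightarrow> (nat \<Rightarrow> 'e)" where
  "path_shift x = (\<lambda>n. x (Suc n))"

lemma topspace_path_space:
  assumes "wf_digraph E"
  shows "topspace (path_space E) = infinite_paths E"
proof -
  interpret wf_digraph E by fact
  have "\<exists>\<beta> \<in> nonempty_paths E. x \<in> cylinder E \<beta>" if "x \<in> infinite_paths E" for x
  proof
    show "[x 0] \<in> nonempty_paths E"
    proof -
      have "x 0 \<in> arcs E"
        using that by (simp add: infinite_paths_def)
      then have "awalk (tail E (x 0)) [x 0] (head E (x 0))"
        by (simp add: awalk_def)
      then show ?thesis
        by (auto simp: nonempty_paths_def)
    qed
    show "x \<in> cylinder E [x 0]"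
      using that by (simp add: cylinder_def)
  qed
  then show ?thesis
    by (auto simp: path_space_def topology_generated_by_topspace cylinder_def)
qed

definition row_finite :: "('v, 'e) pre_digraph \<Rightarrow> bool" where
  "row_finite E \<longleftrightarrow> (\<forall>v \<in> verts E. finite (out_arcs E v))"

definition no_sinks :: "('v, 'e) pre_digraph \<Rightarrow> bool" where
  "no_sinks E \<longleftrightarrow> (\<forall>v \<in> verts E. out_arcs E v \<noteq> {})"

end

theory Submission
  imports Defs
begin

text \<open>
  The inequality \<open>\<ge>\<close> holds because \<open>X\<^sub>H\<close> is a shift-invariant subspace of \<open>X\<close>.

  For \<open>\<le>\<close>, let \<open>\<alpha>\<close> be an open cover of a compact \<open>K\<close>. Compactness gives a \<open>k\<close> such that the
  first \<open>k\<close> edges of \<open>x \<in> K\<close> determine a member of \<open>\<alpha>\<close> containing \<open>x\<close>, and the set \<open>F\<close> of edges at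
  positions \<open>\<le> k\<close> of paths in \<open>K\<close> is finite. Let \<open>H\<close> be the subgraph with edge set \<open>F\<close> and
  \<open>M = |F|\<close>. If \<open>x \<in> K\<^sub>n\<close>, then \<open>x\<^sub>0 \<dots> x\<^sub>n\<close> is a path in \<open>H\<close>; it need not extend to an infinite
  path in \<open>H\<close>, but by the pigeonhole principle it does after dropping its last \<open>M\<close> edges. Hence the
  number of initial segments of length \<open>n + k\<close> of points of \<open>K\<^sub>n\<close> is at most \<open>M\<^bsup>M + k\<^esup>\<close> times the
  cover number of \<open>X\<^sub>H\<close> for the \<open>n\<close>-fold refined cover by first edges, and the constant factor does
  not affect the growth rate.
\<close>

section \<open>Subadditive sequences\<close>

text \<open>Blocks of length \<open>m\<close> are split off one at a time. The remainder
  \<open>r\<close> stays positive because subadditivity is assumed only for positive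
  arguments.\<close>

lemma subadditive_mult_le:
  fixes v :: "nat \<Rightarrow> real"
  assumes "\<And>m n. 1 \<le> m \<Longrightarrow> 1 \<le> n \<Longrightarrow> v (m + n) \<le> v m + v n" "1 \<le> m" "1 \<le> r"
  shows "v (q * m + r) \<le> real q * v m + v r"
proof (induction q)
  case (Suc q)
  have "v (Suc q * m + r) = v (m + (q * m + r))"
    by (simp add: algebra_simps)
  also have "\<dots> \<le> v m + v (q * m + r)"
    using assms by (intro assms(1)) auto
  finally show ?case
    using Suc by (simp add: algebra_simps)
qed simp

text \<open>Fekete's lemma: the limit is the infimum of the quotients over positive
  \<open>n\<close>.\<close>

lemma fekete_convergent:
  fixes v :: "nat \<Rightarrow> real"
  assumes nonneg: "\<And>n. 0 \<le> v n"
    and sub: "\<And>m n. 1 \<le> m \<Longrightarrow> 1 \<le> n \<Longrightarrow> v (m + n) \<le> v m + v n"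
  shows "convergent (\<lambda>n. v n / real n)"
proof -
  define L where "L = (INF n\<in>{1..}. v n / real n)"
  have bdd: "bdd_below ((\<lambda>n. v n / real n) ` {1..})"
    using nonneg by (intro bdd_belowI[of _ 0]) auto
  have "(\<lambda>n. v n / real n) \<longlonglongrightarrow> L"
  proof (rule LIMSEQ_I)
    fix e :: real assume "0 < e"
    then have "L < L + e / 2" by simp
    then obtain m where m: "1 \<le> m" "v m / real m < L + e / 2"
      unfolding L_def using cINF_less_iff[OF _ bdd, of "L + e / 2"] by (auto simp: L_def)
    \<comment> \<open>By nonnegativity the sum dominates every remainder term \<open>v r\<close>
      with \<open>r \<le> m\<close>, so one constant serves for all \<open>n\<close>.\<close>
    define C where "C = (\<Sum>r\<le>m. v r)"
    have "(\<lambda>n. C / real n) \<longlonglongrightarrow> 0"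
      by (rule lim_const_over_n)
    then obtain N where N: "\<And>n. N \<le> n \<Longrightarrow> C / real n < e / 2"
      using order_tendstoD(2)[of "\<lambda>n. C / real n" 0 sequentially "e / 2"] \<open>0 < e\<close>
      by (auto simp: eventually_sequentially)
    have upper: "v n / real n \<le> v m / real m + C / real n" if "1 \<le> n" for n
    proof -
      \<comment> \<open>Dividing \<open>n - 1\<close> instead of \<open>n\<close> puts the remainder
        into \<open>1..m\<close> rather than \<open>0..m - 1\<close>.\<close>
      define q r where "q = (n - 1) div m" and "r = (n - 1) mod m + 1"
      have n: "n = q * m + r"
        using that div_mult_mod_eq[of "n - 1" m] unfolding q_def r_def by linarith
      have r: "1 \<le> r" "r \<le> m"
        using m(1) by (auto simp: r_def Suc_le_eq)
      have "v n \<le> real q * v m + v r"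
        unfolding n by (rule subadditive_mult_le) (use sub m r in auto)
      also have "v r \<le> C"
        unfolding C_def by (rule member_le_sum) (use r nonneg in auto)
      also have "real q \<le> real n / real m"
      proof -
        have "real q * real m \<le> real n"
          using n by (metis le_add1 of_nat_mono of_nat_mult)
        then show ?thesis using m(1) by (simp add: field_simps)
      qed
      finally have "v n \<le> real n / real m * v m + C"
        using nonneg[of m] by (simp add: mult_right_mono)
      then have "v n / real n \<le> (real n / real m * v m + C) / real n"
        by (rule divide_right_mono) simp
      also have "\<dots> = v m / real m + C / real n"
        using that by (simp add: add_divide_distrib)
      finally show ?thesis .
    qed
    have "norm (v n / real n - L) < e" if "max 1 N \<le> n" for n
    proof -
      have "L \<le> v n / real n"
        unfolding L_def by (rule cINF_lower[OF bdd]) (use that in auto)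
      moreover have "v n / real n < L + e"
        using upper[of n] N[of n] m(2) that by linarith
      ultimately show ?thesis unfolding real_norm_def by linarith
    qed
    then show "\<exists>no. \<forall>n\<ge>no. norm (v n / real n - L) < e" by blast
  qed
  then show ?thesis by (auto simp: convergent_def)
qed

text \<open>The \<open>n\<close>-th refined cover involves the \<open>n + 1\<close> times
  \<open>0..n\<close>, so logarithms of cover numbers are subadditive only up to an index shift.
  Moving the index by one leads back to Fekete's lemma, and the factor \<open>(n + 1) / n\<close>
  does not change the limit.\<close>

lemma shifted_fekete_convergent:
  fixes u :: "nat \<Rightarrow> real"
  assumes nonneg: "\<And>n. 0 \<le> u n"
    and sub: "\<And>m n. u (Suc (m + n)) \<le> u m + u n"
  shows "convergent (\<lambda>n. u n / real n)"
proof -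
  define v where "v n = (if n = 0 then 0 else u (n - 1))" for n
  have "convergent (\<lambda>n. v n / real n)"
  proof (rule fekete_convergent)
    fix m n :: nat assume "1 \<le> m" "1 \<le> n"
    then show "v (m + n) \<le> v m + v n"
      using sub[of "m - 1" "n - 1"] by (cases m; cases n) (auto simp: v_def)
  qed (simp add: v_def nonneg)
  then obtain l where "(\<lambda>n. v n / real n) \<longlonglongrightarrow> l"
    by (auto simp: convergent_def)
  then have "(\<lambda>n. v (Suc n) / real (Suc n)) \<longlonglongrightarrow> l"
    by (rule LIMSEQ_Suc)
  moreover have "(\<lambda>n. real (Suc n) / real n) \<longlonglongrightarrow> 1"
    by (rule LIMSEQ_Suc_n_over_n)
  ultimately have "(\<lambda>n. v (Suc n) / real (Suc n) * (real (Suc n) / real n)) \<longlonglongrightarrow> l * 1"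
    by (rule tendsto_mult)
  \<comment> \<open>This includes \<open>n = 0\<close>, where division by zero makes both sides
    0.\<close>
  moreover have "(\<lambda>n. v (Suc n) / real (Suc n) * (real (Suc n) / real n)) = (\<lambda>n. u n / real n)"
    by (simp add: v_def fun_eq_iff del: of_nat_Suc)
  ultimately show ?thesis
    by (simp only: convergent_def) blast
qed


section \<open>Cover numbers\<close>

text \<open>The bound \<open>1 \<le> c\<close> takes care of empty \<open>Y\<close>, whose cover
  number is 1 by convention.\<close>

lemma cover_number_leI:
  assumes "Y \<noteq> {} \<Longrightarrow> \<exists>\<beta>. \<beta> \<subseteq> \<alpha> \<and> finite \<beta> \<and> Y \<subseteq> \<Union>\<beta> \<and> card \<beta> \<le> c" "1 \<le> c"
  shows "cover_number \<alpha> Y \<le> enat c"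
proof (cases "Y = {}")
  case False
  then obtain \<beta> where \<beta>: "\<beta> \<subseteq> \<alpha>" "finite \<beta>" "Y \<subseteq> \<Union>\<beta>" "card \<beta> \<le> c"
    using assms by blast
  then have "cover_number \<alpha> Y \<le> enat (card \<beta>)"
    using False by (auto simp: cover_number_def intro!: INF_lower)
  also have "\<dots> \<le> enat c" using \<beta> by simp
  finally show ?thesis .
qed (use assms in \<open>simp add: cover_number_def one_enat_def\<close>)

lemma cover_number_leE:
  assumes "cover_number \<alpha> Y \<le> enat c" "Y \<noteq> {}"
  obtains \<beta> where "\<beta> \<subseteq> \<alpha>" "finite \<beta>" "Y \<subseteq> \<Union>\<beta>" "card \<beta> \<le> c"
proof -
  let ?S = "{\<beta>. \<beta> \<subseteq> \<alpha> \<and> finite \<beta> \<and> Y \<subseteq> \<Union>\<beta>}"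
  \<comment> \<open>A strict bound below \<open>Suc c\<close> lets the infimum yield an actual
    subfamily.\<close>
  have "(INF \<beta>\<in>?S. enat (card \<beta>)) < enat (Suc c)"
    using assms by (simp add: cover_number_def le_less_trans[of _ "enat c"])
  then obtain \<beta> where "\<beta> \<in> ?S" "enat (card \<beta>) < enat (Suc c)"
    by (auto simp only: INF_less_iff)
  then show ?thesis using that by auto
qed

lemma one_le_cover_number: "1 \<le> cover_number \<alpha> Y"
proof (cases "Y = {}")
  case False
  have "1 \<le> enat (card \<beta>)" if "finite \<beta>" "Y \<subseteq> \<Union>\<beta>" for \<beta>
    using that False by (cases "\<beta> = {}") (auto simp: one_enat_def Suc_le_eq card_gt_0_iff)
  then show ?thesis
    using False by (auto simp: cover_number_def intro!: INF_greatest)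
qed (simp add: cover_number_def)

text \<open>A counting principle: \<open>f\<close> labels the points of \<open>Y\<close> so that all
  points with a given label lie in a common member of \<alpha>. One member per label then covers
  \<open>Y\<close>.\<close>

lemma cover_number_le_classes:
  assumes "finite S" "\<And>x. x \<in> Y \<Longrightarrow> f x \<in> S"
    and "\<And>x. x \<in> Y \<Longrightarrow> \<exists>A\<in>\<alpha>. \<forall>y\<in>Y. f y = f x \<longrightarrow> y \<in> A"
    and "card S \<le> c" "1 \<le> c"
  shows "cover_number \<alpha> Y \<le> enat c"
proof (rule cover_number_leI)
  obtain A where A: "\<And>x. x \<in> Y \<Longrightarrow> A x \<in> \<alpha>" "\<And>x y. x \<in> Y \<Longrightarrow> y \<in> Y \<Longrightarrow> f y = f x \<Longrightarrow> y \<in> A x"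
    using assms(3) by metis
  \<comment> \<open>\<open>A\<close> depends on the point, not on its label. Evaluating it at one
    representative per label bounds the number of members used.\<close>
  let ?rep = "inv_into Y f"
  have rep: "?rep (f x) \<in> Y" "f (?rep (f x)) = f x" if "x \<in> Y" for x
    using that by (auto intro: inv_into_into f_inv_into_f)
  have fin: "finite (f ` Y)" and sub: "f ` Y \<subseteq> S"
    using assms(1,2) by (auto intro: finite_subset)
  let ?\<beta> = "(\<lambda>s. A (?rep s)) ` f ` Y"
  have "card ?\<beta> \<le> card (f ` Y)"
    by (rule card_image_le[OF fin])
  also have "\<dots> \<le> card S"
    by (rule card_mono[OF assms(1) sub])
  finally have "card ?\<beta> \<le> c" using assms(4) by simp
  moreover have "?\<beta> \<subseteq> \<alpha>" using A(1) rep by auto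
  moreover have "Y \<subseteq> \<Union>?\<beta>"
  proof
    fix x assume "x \<in> Y"
    then have "x \<in> A (?rep (f x))" using A(2) rep by metis
    then show "x \<in> \<Union>?\<beta>" using \<open>x \<in> Y\<close> by blast
  qed
  ultimately show "\<exists>\<beta>. \<beta> \<subseteq> \<alpha> \<and> finite \<beta> \<and> Y \<subseteq> \<Union>\<beta> \<and> card \<beta> \<le> c"
    using fin by blast
qed (rule assms(5))

section \<open>Entropy of an open cover\<close>

lemma iter_preimage_Int:
  "iter_preimage T \<sigma> i (A \<inter> B) = iter_preimage T \<sigma> i A \<inter> iter_preimage T \<sigma> i B"
  by (auto simp: iter_preimage_def)

lemma funpow_in_topspace:
  assumes "\<sigma> ` topspace T \<subseteq> topspace T" "x \<in> topspace T"
  shows "(\<sigma> ^^ i) x \<in> topspace T"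
  using assms by (induction i) auto

lemma iter_preimage_iter_preimage:
  assumes "\<sigma> ` topspace T \<subseteq> topspace T"
  shows "iter_preimage T \<sigma> i (iter_preimage T \<sigma> j A) = iter_preimage T \<sigma> (i + j) A"
proof -
  have "(\<sigma> ^^ j) ((\<sigma> ^^ i) x) = (\<sigma> ^^ (i + j)) x" for x
    by (simp add: funpow_add add.commute[of i j])
  then show ?thesis
    using funpow_in_topspace[OF assms] by (auto simp: iter_preimage_def)
qed

text \<open>A member of the refinement is a choice of a member of \<alpha> at each time. The
  hypothesis matters at time 0, where \<open>refined_cover\<close> is \<alpha> itself while
  \<open>iter_preimage\<close> cuts down to the space.\<close>

lemma refined_cover_eq:
  assumes "\<And>A. A \<in> \<alpha> \<Longrightarrow> A \<subseteq> topspace T"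
  shows "refined_cover T \<sigma> \<alpha> n =
    {(\<Inter>i\<le>n. iter_preimage T \<sigma> i (f i)) | f. \<forall>i\<le>n. f i \<in> \<alpha>}"
proof (induction n)
  case 0
  have "iter_preimage T \<sigma> 0 A = A" if "A \<in> \<alpha>" for A
    using assms[OF that] by (auto simp: iter_preimage_def)
  have "\<exists>f. A = iter_preimage T \<sigma> 0 (f 0) \<and> f 0 \<in> \<alpha>" if "A \<in> \<alpha>" for A
    using \<open>\<And>A. A \<in> \<alpha> \<Longrightarrow> iter_preimage T \<sigma> 0 A = A\<close>[OF that] that by (intro exI[of _ "\<lambda>_. A"]) simp
  then show ?case
    using \<open>\<And>A. A \<in> \<alpha> \<Longrightarrow> iter_preimage T \<sigma> 0 A = A\<close> by auto
next
  case (Suc n)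
  show ?case
  proof (intro equalityI subsetI)
    fix B assume "B \<in> refined_cover T \<sigma> \<alpha> (Suc n)"
    then obtain f A where f: "\<forall>i\<le>n. f i \<in> \<alpha>" "A \<in> \<alpha>"
      "B = (\<Inter>i\<le>n. iter_preimage T \<sigma> i (f i)) \<inter> iter_preimage T \<sigma> (Suc n) A"
      by (auto simp: Suc cover_join_def)
    then have "B = (\<Inter>i\<le>Suc n. iter_preimage T \<sigma> i ((f(Suc n := A)) i))"
      by (auto simp: atMost_Suc)
    moreover have "\<forall>i\<le>Suc n. (f(Suc n := A)) i \<in> \<alpha>"
      using f by (auto simp: le_Suc_eq)
    ultimately show "B \<in> {(\<Inter>i\<le>Suc n. iter_preimage T \<sigma> i (f i)) | f. \<forall>i\<le>Suc n. f i \<in> \<alpha>}"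
      by blast
  next
    fix B assume "B \<in> {(\<Inter>i\<le>Suc n. iter_preimage T \<sigma> i (f i)) | f. \<forall>i\<le>Suc n. f i \<in> \<alpha>}"
    then obtain f where f: "\<forall>i\<le>Suc n. f i \<in> \<alpha>" "B = (\<Inter>i\<le>Suc n. iter_preimage T \<sigma> i (f i))"
      by auto
    then have "B = (\<Inter>i\<le>n. iter_preimage T \<sigma> i (f i)) \<inter> iter_preimage T \<sigma> (Suc n) (f (Suc n))"
      by (auto simp: atMost_Suc)
    moreover have "(\<Inter>i\<le>n. iter_preimage T \<sigma> i (f i)) \<in> refined_cover T \<sigma> \<alpha> n"
      unfolding Suc using f(1) by (intro CollectI exI[of _ f]) simp
    moreover have "iter_preimage T \<sigma> (Suc n) (f (Suc n)) \<in> iter_preimage T \<sigma> (Suc n) ` \<alpha>"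
      using f(1) by simp
    ultimately show "B \<in> refined_cover T \<sigma> \<alpha> (Suc n)"
      unfolding refined_cover.simps(2) cover_join_def by blast
  qed
qed

text \<open>The times \<open>0..m + n + 1\<close> split into \<open>0..m\<close> and
  \<open>m + 1..m + n + 1\<close>; the second block is the \<open>n\<close>-th refinement pulled
  back by \<open>m + 1\<close> steps.\<close>

lemma refined_cover_Int_iter_preimage:
  assumes "\<sigma> ` topspace T \<subseteq> topspace T" "A \<in> refined_cover T \<sigma> \<alpha> m" "B \<in> refined_cover T \<sigma> \<alpha> n"
  shows "A \<inter> iter_preimage T \<sigma> (Suc m) B \<in> refined_cover T \<sigma> \<alpha> (Suc (m + n))"
  using assms(3)
proof (induction n arbitrary: B)
  case 0
  then show ?case using assms(2) by (auto simp: cover_join_def)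
next
  case (Suc n)
  then obtain B' D where B: "B = B' \<inter> iter_preimage T \<sigma> (Suc n) D"
    "B' \<in> refined_cover T \<sigma> \<alpha> n" "D \<in> \<alpha>"
    by (auto simp: cover_join_def)
  have "A \<inter> iter_preimage T \<sigma> (Suc m) B =
      (A \<inter> iter_preimage T \<sigma> (Suc m) B') \<inter> iter_preimage T \<sigma> (Suc (Suc (m + n))) D"
    by (simp only: B iter_preimage_Int iter_preimage_iter_preimage[OF assms(1)])
      (simp add: Int_assoc)
  also have "\<dots> \<in> refined_cover T \<sigma> \<alpha> (Suc (m + Suc n))"
    using Suc.IH[OF B(2)] B(3)
    unfolding add_Suc_right refined_cover.simps(2)[of _ _ _ "Suc (m + n)"] cover_join_def by blast
  finally show ?case .
qed

lemma orbit_part_add: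
  assumes "\<sigma> ` topspace T \<subseteq> topspace T"
  shows "orbit_part T \<sigma> K (Suc (m + n)) =
    orbit_part T \<sigma> K m \<inter> iter_preimage T \<sigma> (Suc m) (orbit_part T \<sigma> K n)"
proof -
  have *: "(\<sigma> ^^ (Suc m + j)) x = (\<sigma> ^^ j) ((\<sigma> ^^ Suc m) x)" for j x
    by (metis add.commute comp_apply funpow_add)
  have split: "(\<forall>i\<le>Suc (m + n). P i) \<longleftrightarrow> (\<forall>i\<le>m. P i) \<and> (\<forall>j\<le>n. P (Suc m + j))" for P
  proof -
    have "i \<le> m \<or> (\<exists>j\<le>n. i = Suc m + j)" if "i \<le> Suc (m + n)" for i
      using that by presburger
    then show ?thesis by fastforce
  qed
  have orbit: "orbit_part T \<sigma> K n = {x \<in> topspace T. \<forall>i\<le>n. (\<sigma> ^^ i) x \<in> K}" for n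
    by (auto simp: orbit_part_def iter_preimage_def)
  show ?thesis
    unfolding orbit split iter_preimage_def *
    using funpow_in_topspace[OF assms] by blast
qed

text \<open>Each member of a subcover for the first time block is intersected with each pulled-back
  member of a subcover for the second.\<close>

lemma cover_number_submultiplicative:
  assumes "\<sigma> ` topspace T \<subseteq> topspace T"
    and a: "cover_number (refined_cover T \<sigma> \<alpha> m) (orbit_part T \<sigma> K m) \<le> enat a"
    and b: "cover_number (refined_cover T \<sigma> \<alpha> n) (orbit_part T \<sigma> K n) \<le> enat b"
  shows "cover_number (refined_cover T \<sigma> \<alpha> (Suc (m + n))) (orbit_part T \<sigma> K (Suc (m + n)))
    \<le> enat (a * b)"
proof (rule cover_number_leI)
  let ?p = "iter_preimage T \<sigma> (Suc m)"
  have "1 \<le> enat a" "1 \<le> enat b"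
    using a b one_le_cover_number order_trans by blast+
  then show "1 \<le> a * b" by (simp add: one_enat_def)
  assume ne: "orbit_part T \<sigma> K (Suc (m + n)) \<noteq> {}"
  then have "orbit_part T \<sigma> K m \<noteq> {}" "orbit_part T \<sigma> K n \<noteq> {}"
    by (auto simp: orbit_part_add[OF assms(1)] iter_preimage_def)
  then obtain \<beta> \<gamma> where
    \<beta>: "\<beta> \<subseteq> refined_cover T \<sigma> \<alpha> m" "finite \<beta>" "orbit_part T \<sigma> K m \<subseteq> \<Union>\<beta>" "card \<beta> \<le> a" and
    \<gamma>: "\<gamma> \<subseteq> refined_cover T \<sigma> \<alpha> n" "finite \<gamma>" "orbit_part T \<sigma> K n \<subseteq> \<Union>\<gamma>" "card \<gamma> \<le> b"
    using cover_number_leE[OF a] cover_number_leE[OF b] by metis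
  let ?\<delta> = "(\<lambda>(A, B). A \<inter> ?p B) ` (\<beta> \<times> \<gamma>)"
  have "card ?\<delta> \<le> card (\<beta> \<times> \<gamma>)"
    using \<beta>(2) \<gamma>(2) by (intro card_image_le) simp
  also have "\<dots> \<le> a * b"
    using \<beta>(4) \<gamma>(4) by (simp add: card_cartesian_product mult_le_mono)
  finally have "card ?\<delta> \<le> a * b" .
  moreover have "?\<delta> \<subseteq> refined_cover T \<sigma> \<alpha> (Suc (m + n))"
    using \<beta>(1) \<gamma>(1) refined_cover_Int_iter_preimage[OF assms(1)] by fastforce
  moreover have "orbit_part T \<sigma> K (Suc (m + n)) \<subseteq> \<Union>?\<delta>"
  proof
    fix x assume "x \<in> orbit_part T \<sigma> K (Suc (m + n))"
    then have x: "x \<in> orbit_part T \<sigma> K m" "x \<in> topspace T" "(\<sigma> ^^ Suc m) x \<in> orbit_part T \<sigma> K n"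
      by (simp_all add: orbit_part_add[OF assms(1)] iter_preimage_def)
    then obtain A B where "A \<in> \<beta>" "B \<in> \<gamma>" "x \<in> A" "(\<sigma> ^^ Suc m) x \<in> B"
      using \<beta>(3) \<gamma>(3) by blast
    then show "x \<in> \<Union>?\<delta>"
      using x(2) by (force simp: iter_preimage_def)
  qed
  ultimately show "\<exists>\<delta>. \<delta> \<subseteq> refined_cover T \<sigma> \<alpha> (Suc (m + n)) \<and> finite \<delta> \<and>
      orbit_part T \<sigma> K (Suc (m + n)) \<subseteq> \<Union>\<delta> \<and> card \<delta> \<le> a * b"
    using \<beta>(2) \<gamma>(2) by blast
qed

section \<open>Existence of the limit defining the entropy of a cover\<close>

lemma cover_number_compact:
  assumes "compactin T K" "open_cover T K \<alpha>"
  obtains c where "cover_number \<alpha> K \<le> enat c"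
proof -
  obtain \<F> where "finite \<F>" "\<F> \<subseteq> \<alpha>" "K \<subseteq> \<Union>\<F>"
    using assms unfolding compactin_def open_cover_def by blast
  then have "cover_number \<alpha> K \<le> enat (max 1 (card \<F>))"
    by (intro cover_number_leI) auto
  then show ?thesis by (rule that)
qed

text \<open>Gives access to the entropy as a limit of real numbers, so that comparisons can be made
  between finite cover numbers.\<close>

lemma entropy_cover_limit:
  assumes \<sigma>: "\<sigma> ` topspace T \<subseteq> topspace T" and K: "compactin T K" and \<alpha>: "open_cover T K \<alpha>"
  obtains c l where
    "\<And>n. cover_number (refined_cover T \<sigma> \<alpha> n) (orbit_part T \<sigma> K n) = enat (c n)"
    "\<And>n. 1 \<le> c n" "(\<lambda>n. ln (real (c n)) / real n) \<longlonglongrightarrow> l" "entropy_cover T \<sigma> K \<alpha> = ereal l"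
proof -
  let ?N = "\<lambda>n. cover_number (refined_cover T \<sigma> \<alpha> n) (orbit_part T \<sigma> K n)"
  have K0: "orbit_part T \<sigma> K 0 = K"
    using compactin_subset_topspace[OF K] by (auto simp: orbit_part_def iter_preimage_def)
  obtain a where a: "?N 0 \<le> enat a"
    using cover_number_compact[OF K \<alpha>] by (auto simp: K0)
  have "\<exists>c. ?N n = enat c" for n
  proof -
    \<comment> \<open>Finiteness passes from \<open>n\<close> to \<open>n + 1\<close> by
      submultiplicativity; compactness enters at \<open>n = 0\<close>.\<close>
    have "\<exists>b. ?N n \<le> enat b"
    proof (induction n)
      case (Suc n)
      then show ?case using cover_number_submultiplicative[OF \<sigma> _ a, of n] by auto
    qed (use a in blast)
    then show ?thesis by (metis enat_ile)
  qed
  then obtain c where c: "\<And>n. ?N n = enat (c n)" by metis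
  have c1: "1 \<le> c n" for n
    using one_le_cover_number[of "refined_cover T \<sigma> \<alpha> n" "orbit_part T \<sigma> K n"]
    by (simp add: c one_enat_def)
  have "convergent (\<lambda>n. ln (real (c n)) / real n)"
  proof (rule shifted_fekete_convergent)
    show "0 \<le> ln (real (c n))" for n using c1[of n] by simp
    fix m n
    have "c (Suc (m + n)) \<le> c m * c n"
      using cover_number_submultiplicative[OF \<sigma>, of \<alpha> m K "c m" n "c n"] by (simp only: c order_refl enat_ord_simps)
    then have "real (c (Suc (m + n))) \<le> real (c m) * real (c n)"
      by (metis of_nat_mono of_nat_mult)
    moreover have pos: "0 < c k" for k using c1[of k] by linarith
    ultimately have "ln (real (c (Suc (m + n)))) \<le> ln (real (c m) * real (c n))"
      by (subst ln_le_cancel_iff) auto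
    then show "ln (real (c (Suc (m + n)))) \<le> ln (real (c m)) + ln (real (c n))"
      using pos by (simp add: ln_mult)
  qed
  then obtain l where l: "(\<lambda>n. ln (real (c n)) / real n) \<longlonglongrightarrow> l"
    by (auto simp: convergent_def)
  have "(\<lambda>n. ereal (ln (real (c n)) / real n)) \<longlonglongrightarrow> ereal l"
    using l by simp
  \<comment> \<open>At \<open>n = 0\<close> the real quotient is 0, whereas the \<open>ereal\<close>
    quotient need not be; hence equality is claimed only eventually.\<close>
  moreover have "\<forall>\<^sub>F n in sequentially. ereal (ln (real (c n)) / real n) =
      cover_entropy (refined_cover T \<sigma> \<alpha> n) (orbit_part T \<sigma> K n) / ereal (real n)"
    using eventually_gt_at_top[of 0] by eventually_elim (simp add: cover_entropy_def c)
  ultimately have "(\<lambda>n. cover_entropy (refined_cover T \<sigma> \<alpha> n) (orbit_part T \<sigma> K n) / ereal (real n))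
      \<longlonglongrightarrow> ereal l"
    by (rule Lim_transform_eventually)
  then have "entropy_cover T \<sigma> K \<alpha> = ereal l"
    unfolding entropy_cover_def by (rule limI)
  with c c1 l show ?thesis by (rule that)
qed

text \<open>A constant factor \<open>C\<close> between cover numbers adds \<open>ln C / n\<close> to
  the growth rate, which tends to 0. The two covers may belong to different systems.\<close>

lemma entropy_cover_le:
  assumes "\<sigma> ` topspace T \<subseteq> topspace T" "compactin T K" "open_cover T K \<alpha>"
    and "\<tau> ` topspace S \<subseteq> topspace S" "compactin S L" "open_cover S L \<beta>"
    and le: "\<forall>\<^sub>F n in sequentially. cover_number (refined_cover T \<sigma> \<alpha> n) (orbit_part T \<sigma> K n) \<le>
      enat C * cover_number (refined_cover S \<tau> \<beta> n) (orbit_part S \<tau> L n)"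
  shows "entropy_cover T \<sigma> K \<alpha> \<le> entropy_cover S \<tau> L \<beta>"
proof -
  obtain a l where a: "\<And>n. cover_number (refined_cover T \<sigma> \<alpha> n) (orbit_part T \<sigma> K n) = enat (a n)"
    "\<And>n. 1 \<le> a n" "(\<lambda>n. ln (real (a n)) / real n) \<longlonglongrightarrow> l" "entropy_cover T \<sigma> K \<alpha> = ereal l"
    using entropy_cover_limit[OF assms(1-3)] by metis
  obtain b l' where b: "\<And>n. cover_number (refined_cover S \<tau> \<beta> n) (orbit_part S \<tau> L n) = enat (b n)"
    "\<And>n. 1 \<le> b n" "(\<lambda>n. ln (real (b n)) / real n) \<longlonglongrightarrow> l'" "entropy_cover S \<tau> L \<beta> = ereal l'"
    using entropy_cover_limit[OF assms(4-6)] by metis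
  have "(\<lambda>n. ln (real C) / real n + ln (real (b n)) / real n) \<longlonglongrightarrow> 0 + l'"
    by (intro tendsto_add b(3) lim_const_over_n)
  moreover have "\<forall>\<^sub>F n in sequentially.
      ln (real (a n)) / real n \<le> ln (real C) / real n + ln (real (b n)) / real n"
    using le
  proof eventually_elim
    case (elim n)
    then have ab: "a n \<le> C * b n" by (simp add: a(1) b(1))
    have pos: "0 < a n" "0 < b n" using a(2)[of n] b(2)[of n] by linarith+
    then have "0 < C" using ab by (cases C) auto
    have "real (a n) \<le> real C * real (b n)"
      using ab by (metis of_nat_mono of_nat_mult)
    then have "ln (real (a n)) \<le> ln (real C * real (b n))"
      using pos \<open>0 < C\<close> by (subst ln_le_cancel_iff) auto
    also have "\<dots> = ln (real C) + ln (real (b n))"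
      using pos \<open>0 < C\<close> by (simp add: ln_mult)
    finally show ?case
      by (simp add: divide_right_mono flip: add_divide_distrib)
  qed
  ultimately have "l \<le> 0 + l'"
    using a(3) by (intro tendsto_le[OF sequentially_bot]) auto
  then show ?thesis by (simp add: a(4) b(4))
qed

text \<open>Open covers in the subspace lift to open covers in the whole space. Orbits starting in
  \<open>Y\<close> stay there, so taking traces on \<open>Y\<close> commutes with refinement and
  cover numbers do not grow.\<close>

lemma top_entropy_subtopology_le:
  assumes \<sigma>: "\<sigma> ` topspace T \<subseteq> topspace T" and Y: "Y \<subseteq> topspace T" "\<sigma> ` Y \<subseteq> Y"
  shows "top_entropy (subtopology T Y) \<sigma> \<le> top_entropy T \<sigma>"
proof -
  let ?S = "subtopology T Y"
  have top: "topspace ?S = Y"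
    using Y(1) by (simp add: Int_absorb1)
  have iter: "(\<sigma> ^^ i) x \<in> Y" if "x \<in> Y" for i x
    using funpow_in_topspace[of \<sigma> ?S, unfolded top, OF Y(2) that] .
  have "entropy_cover ?S \<sigma> K \<alpha> \<le> top_entropy T \<sigma>"
    if K: "compactin ?S K" and \<alpha>: "open_cover ?S K \<alpha>" for K \<alpha>
  proof -
    have KT: "compactin T K" "K \<subseteq> Y"
      using K by (auto simp: compactin_subtopology)
    \<comment> \<open>Taking all open sets with trace in \<alpha> avoids choosing a lift for each
      member.\<close>
    define \<alpha>' where "\<alpha>' = {A. openin T A \<and> A \<inter> Y \<in> \<alpha>}"
    have "K \<subseteq> \<Union>\<alpha>'"
    proof
      fix x assume "x \<in> K"
      then obtain A where A: "A \<in> \<alpha>" "x \<in> A" "openin ?S A"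
        using \<alpha> by (auto simp: open_cover_def)
      then obtain B where "openin T B" "A = B \<inter> Y"
        by (auto simp: openin_subtopology)
      then show "x \<in> \<Union>\<alpha>'" using A by (auto simp: \<alpha>'_def)
    qed
    then have \<alpha>': "open_cover T K \<alpha>'"
      by (auto simp: open_cover_def \<alpha>'_def)
    have orbit: "orbit_part ?S \<sigma> K n = orbit_part T \<sigma> K n" "orbit_part T \<sigma> K n \<subseteq> Y" for n
    proof -
      have "(\<forall>i\<le>n. (\<sigma> ^^ i) x \<in> K) \<Longrightarrow> x \<in> Y" for x
        using KT(2) by (metis funpow_0 le0 subsetD)
      then show "orbit_part ?S \<sigma> K n = orbit_part T \<sigma> K n" "orbit_part T \<sigma> K n \<subseteq> Y"
        using Y(1) by (auto simp: orbit_part_def iter_preimage_def top)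
    qed
    have restrict: "B \<inter> Y \<in> refined_cover ?S \<sigma> \<alpha> n" if B: "B \<in> refined_cover T \<sigma> \<alpha>' n" for B n
    proof -
      obtain f where f: "B = (\<Inter>i\<le>n. iter_preimage T \<sigma> i (f i))" "\<forall>i\<le>n. f i \<in> \<alpha>'"
        using B by (subst (asm) refined_cover_eq) (auto simp: \<alpha>'_def openin_subset)
      have "B \<inter> Y = (\<Inter>i\<le>n. iter_preimage ?S \<sigma> i (f i \<inter> Y))"
        using Y(1) iter by (auto simp: f(1) iter_preimage_def top)
      moreover have "\<forall>i\<le>n. f i \<inter> Y \<in> \<alpha>"
        using f(2) by (auto simp: \<alpha>'_def)
      moreover have "A \<subseteq> topspace ?S" if "A \<in> \<alpha>" for A
        using \<alpha> that openin_subset unfolding open_cover_def by blast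
      ultimately show ?thesis
        by (subst refined_cover_eq) auto
    qed
    have "cover_number (refined_cover ?S \<sigma> \<alpha> n) (orbit_part ?S \<sigma> K n) \<le>
        enat 1 * cover_number (refined_cover T \<sigma> \<alpha>' n) (orbit_part T \<sigma> K n)" for n
    proof (cases "cover_number (refined_cover T \<sigma> \<alpha>' n) (orbit_part T \<sigma> K n)")
      case (enat c)
      have "cover_number (refined_cover ?S \<sigma> \<alpha> n) (orbit_part T \<sigma> K n) \<le> enat c"
      proof (rule cover_number_leI)
        show "1 \<le> c"
          using one_le_cover_number[of "refined_cover T \<sigma> \<alpha>' n" "orbit_part T \<sigma> K n"]
          by (simp add: enat one_enat_def)
        assume "orbit_part T \<sigma> K n \<noteq> {}"
        then obtain \<beta> where \<beta>: "\<beta> \<subseteq> refined_cover T \<sigma> \<alpha>' n" "finite \<beta>"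
          "orbit_part T \<sigma> K n \<subseteq> \<Union>\<beta>" "card \<beta> \<le> c"
          using cover_number_leE[of "refined_cover T \<sigma> \<alpha>' n" "orbit_part T \<sigma> K n" c] enat
          by auto
        have "card ((\<lambda>B. B \<inter> Y) ` \<beta>) \<le> c"
          using \<beta>(2,4) card_image_le order_trans by blast
        moreover have "orbit_part T \<sigma> K n \<subseteq> \<Union>((\<lambda>B. B \<inter> Y) ` \<beta>)"
          using \<beta>(3) orbit(2) by blast
        ultimately show "\<exists>\<beta>. \<beta> \<subseteq> refined_cover ?S \<sigma> \<alpha> n \<and> finite \<beta> \<and>
            orbit_part T \<sigma> K n \<subseteq> \<Union>\<beta> \<and> card \<beta> \<le> c"
          using \<beta>(1,2) restrict by (intro exI[of _ "(\<lambda>B. B \<inter> Y) ` \<beta>"]) auto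
      qed
      then show ?thesis by (simp add: orbit enat)
    qed simp
    then have "entropy_cover ?S \<sigma> K \<alpha> \<le> entropy_cover T \<sigma> K \<alpha>'"
      using \<sigma> Y(2) K \<alpha> KT(1) \<alpha>'
      by (intro entropy_cover_le[where C = 1]) (simp_all add: top del: topspace_subtopology)
    also have "\<dots> \<le> entropy_compact T \<sigma> K"
      unfolding entropy_compact_def using \<alpha>' by (intro SUP_upper) simp
    also have "\<dots> \<le> top_entropy T \<sigma>"
      unfolding top_entropy_def using KT(1) by (intro SUP_upper) simp
    finally show ?thesis .
  qed
  then show ?thesis
    unfolding top_entropy_def[of ?S] entropy_compact_def by (intro SUP_least) auto
qed


section \<open>The path space\<close>

text \<open>A common ambient space for the path spaces of a graph and its subgraphs. Its product
  topology provides Tychonoff's theorem and continuous coordinates.\<close>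

abbreviation sequence_space :: "(nat \<Rightarrow> 'e) topology" where
  "sequence_space \<equiv> product_topology (\<lambda>_. discrete_topology UNIV) UNIV"

text \<open>A basic box restricts finitely many coordinates, so it contains every sequence that
  agrees with \<open>x\<close> beyond the last of them.\<close>

lemma openin_sequence_space:
  "openin sequence_space U \<longleftrightarrow> (\<forall>x\<in>U. \<exists>k. \<forall>y. (\<forall>i<k. y i = x i) \<longrightarrow> y \<in> U)"
proof (intro iffI ballI)
  fix x assume U: "openin sequence_space U" "x \<in> U"
  then have "\<exists>V. finite {i. V i \<noteq> UNIV} \<and> (\<forall>i. x i \<in> V i) \<and> PiE UNIV V \<subseteq> U"
    by (simp add: openin_product_topology_alt PiE_UNIV_domain Pi_iff)
  then obtain V where V: "finite {i. V i \<noteq> UNIV}" "\<forall>i. x i \<in> V i" "PiE UNIV V \<subseteq> U"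
    by blast
  then obtain k where k: "\<And>i. V i \<noteq> UNIV \<Longrightarrow> i < k"
    using finite_nat_set_iff_bounded[of "{i. V i \<noteq> UNIV}"] by auto
  have "y \<in> U" if "\<forall>i<k. y i = x i" for y
  proof -
    have "y i \<in> V i" for i
      using k[of i] that V(2) by (cases "i < k") auto
    then show ?thesis using V(3) by auto
  qed
  then show "\<exists>k. \<forall>y. (\<forall>i<k. y i = x i) \<longrightarrow> y \<in> U" by blast
next
  assume *: "\<forall>x\<in>U. \<exists>k. \<forall>y. (\<forall>i<k. y i = x i) \<longrightarrow> y \<in> U"
  have "\<exists>V. finite {i. V i \<noteq> UNIV} \<and> (\<forall>i. x i \<in> V i) \<and> PiE UNIV V \<subseteq> U" if x: "x \<in> U" for x
  proof -
    obtain k where k: "\<And>y. (\<forall>i<k. y i = x i) \<Longrightarrow> y \<in> U"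
      using * x by blast
    let ?V = "\<lambda>i. if i < k then {x i} else UNIV"
    have "finite {i. ?V i \<noteq> UNIV}"
      by (rule finite_subset[of _ "{..<k}"]) auto
    moreover have "PiE UNIV ?V \<subseteq> U"
    proof
      fix y assume y: "y \<in> PiE UNIV ?V"
      have "y i = x i" if "i < k" for i
        using PiE_mem[OF y, of i] that by simp
      then show "y \<in> U" by (intro k) simp
    qed
    moreover have "\<forall>i. x i \<in> ?V i" by simp
    ultimately show ?thesis by (intro exI[of _ ?V] conjI)
  qed
  then show "openin sequence_space U"
    by (simp add: openin_product_topology_alt PiE_UNIV_domain Pi_iff)
qed

section \<open>The cylinder topology as a subspace of the sequence space\<close>

lemma infinite_path_prefix:
  assumes "wf_digraph E" "x \<in> infinite_paths E"
  shows "map x [0..<Suc k] \<in> nonempty_paths E"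
proof -
  interpret wf_digraph E by fact
  \<comment> \<open>Only the linking condition is kept and \<open>x\<close> is arbitrary, so that
    the induction hypothesis applies to the shifted sequence.\<close>
  have "cas (tail E (x 0)) (map x [0..<Suc k]) (head E (x k))"
    if "\<And>n. tail E (x (Suc n)) = head E (x n)" for x
    using that
  proof (induction k arbitrary: x)
    case (Suc k)
    have "map x [0..<Suc (Suc k)] = x 0 # map (\<lambda>n. x (Suc n)) [0..<Suc k]"
      by (rule map_upt_Suc)
    then show ?case
      using Suc.IH[of "\<lambda>n. x (Suc n)"] Suc.prems by (simp del: upt_Suc)
  qed simp
  then have "awalk (tail E (x 0)) (map x [0..<Suc k]) (head E (x k))"
    using assms(2) by (auto simp: awalk_def infinite_paths_def)
  then show ?thesis
    unfolding nonempty_paths_def by (auto simp del: upt_Suc)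
qed

text \<open>The criterion holds for cylinders and survives intersections (take the longer prefix)
  and unions. Conversely, such a set is the union of cylinders around its points.\<close>

lemma openin_path_space:
  assumes "wf_digraph E"
  shows "openin (path_space E) U \<longleftrightarrow> U \<subseteq> infinite_paths E \<and>
    (\<forall>x\<in>U. \<exists>k. \<forall>y\<in>infinite_paths E. (\<forall>i<k. y i = x i) \<longrightarrow> y \<in> U)"
proof
  assume U: "openin (path_space E) U"
  then have "generate_topology_on (cylinder E ` nonempty_paths E) U"
    by (simp add: path_space_def openin_topology_generated_by_iff)
  then have "\<forall>x\<in>U. \<exists>k. \<forall>y\<in>infinite_paths E. (\<forall>i<k. y i = x i) \<longrightarrow> y \<in> U"
  proof induction
    case (Int A B)
    show ?case
    proof
      fix x assume "x \<in> A \<inter> B"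
      then obtain k l where
        "\<forall>y\<in>infinite_paths E. (\<forall>i<k. y i = x i) \<longrightarrow> y \<in> A"
        "\<forall>y\<in>infinite_paths E. (\<forall>i<l. y i = x i) \<longrightarrow> y \<in> B"
        using Int.IH by blast
      then show "\<exists>k. \<forall>y\<in>infinite_paths E. (\<forall>i<k. y i = x i) \<longrightarrow> y \<in> A \<inter> B"
        by (intro exI[of _ "max k l"]) auto
    qed
  next
    case (UN \<A>)
    show ?case
    proof
      fix x assume "x \<in> \<Union>\<A>"
      then obtain A where A: "A \<in> \<A>" "x \<in> A" by blast
      then obtain k where "\<forall>y\<in>infinite_paths E. (\<forall>i<k. y i = x i) \<longrightarrow> y \<in> A"
        using UN.IH by blast
      then show "\<exists>k. \<forall>y\<in>infinite_paths E. (\<forall>i<k. y i = x i) \<longrightarrow> y \<in> \<Union>\<A>"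
        using A(1) by blast
    qed
  next
    case (Basis A)
    then obtain \<beta> where "A = cylinder E \<beta>" by blast
    then show ?case by (auto simp: cylinder_def intro!: exI[of _ "length \<beta>"])
  qed simp
  then show "U \<subseteq> infinite_paths E \<and>
      (\<forall>x\<in>U. \<exists>k. \<forall>y\<in>infinite_paths E. (\<forall>i<k. y i = x i) \<longrightarrow> y \<in> U)"
    using openin_subset[OF U] topspace_path_space[OF assms] by simp
next
  assume U: "U \<subseteq> infinite_paths E \<and>
    (\<forall>x\<in>U. \<exists>k. \<forall>y\<in>infinite_paths E. (\<forall>i<k. y i = x i) \<longrightarrow> y \<in> U)"
  from bchoice[OF conjunct2[OF this]] obtain k where k:
    "\<And>x y. x \<in> U \<Longrightarrow> y \<in> infinite_paths E \<Longrightarrow> \<forall>i<k x. y i = x i \<Longrightarrow> y \<in> U"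
    by blast
  \<comment> \<open>\<open>Suc\<close> keeps the prefix nonempty when \<open>k x = 0\<close>, since
    cylinders are indexed by paths of length at least 1.\<close>
  have "U = (\<Union>x\<in>U. cylinder E (map x [0..<Suc (k x)]))"
  proof (intro equalityI subsetI)
    fix x assume "x \<in> U"
    moreover have "x \<in> cylinder E (map x [0..<Suc (k x)])"
      using U \<open>x \<in> U\<close> by (auto simp: cylinder_def simp del: upt_Suc)
    ultimately show "x \<in> (\<Union>x\<in>U. cylinder E (map x [0..<Suc (k x)]))" by blast
  next
    fix y assume "y \<in> (\<Union>x\<in>U. cylinder E (map x [0..<Suc (k x)]))"
    then obtain x where "x \<in> U" "y \<in> infinite_paths E" "\<forall>i<k x. y i = x i"
      by (auto simp: cylinder_def simp del: upt_Suc)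
    then show "y \<in> U" by (rule k)
  qed
  moreover have "openin (path_space E) (cylinder E (map x [0..<Suc (k x)]))" if "x \<in> U" for x
    unfolding path_space_def using infinite_path_prefix[OF assms] U that
    by (intro topology_generated_by_Basis imageI) blast
  then have "openin (path_space E) (\<Union>x\<in>U. cylinder E (map x [0..<Suc (k x)]))"
    by (intro openin_Union) blast
  ultimately show "openin (path_space E) U" by (rule ssubst)
qed

lemma path_space_eq_subtopology:
  assumes "wf_digraph E"
  shows "path_space E = subtopology sequence_space (infinite_paths E)"
proof -
  let ?X = "infinite_paths E"
  have "openin (path_space E) U \<longleftrightarrow> openin (subtopology sequence_space ?X) U" for U
  proof
    assume "openin (path_space E) U"
    then have U: "U \<subseteq> ?X" "\<forall>x\<in>U. \<exists>k. \<forall>y\<in>?X. (\<forall>i<k. y i = x i) \<longrightarrow> y \<in> U"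
      by (simp_all add: openin_path_space[OF assms])
    from bchoice[OF U(2)] obtain k where
      k: "\<And>x y. x \<in> U \<Longrightarrow> y \<in> ?X \<Longrightarrow> \<forall>i<k x. y i = x i \<Longrightarrow> y \<in> U"
      by blast
    define V where "V = (\<Union>x\<in>U. {y. \<forall>i<k x. y i = x i})"
    have "openin sequence_space {y. \<forall>i<k x. y i = x i}" for x
      unfolding openin_sequence_space by (auto intro!: exI[of _ "k x"])
    then have "openin sequence_space V"
      unfolding V_def by (intro openin_Union) blast
    moreover have "U = V \<inter> ?X"
    proof (intro equalityI subsetI)
      fix y assume "y \<in> V \<inter> ?X"
      then show "y \<in> U" unfolding V_def by (elim IntE UN_E CollectE) (rule k)
    qed (use U(1) in \<open>auto simp: V_def\<close>)
    ultimately show "openin (subtopology sequence_space ?X) U"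
      unfolding openin_subtopology by blast
  next
    assume "openin (subtopology sequence_space ?X) U"
    then obtain V where V: "openin sequence_space V" "U = V \<inter> ?X"
      by (auto simp: openin_subtopology)
    show "openin (path_space E) U"
      unfolding openin_path_space[OF assms]
    proof (intro conjI ballI)
      fix x assume "x \<in> U"
      then obtain k where "\<forall>y. (\<forall>i<k. y i = x i) \<longrightarrow> y \<in> V"
        using V unfolding openin_sequence_space by auto
      then show "\<exists>k. \<forall>y\<in>?X. (\<forall>i<k. y i = x i) \<longrightarrow> y \<in> U"
        using V(2) by (intro exI[of _ k]) simp
    qed (use V(2) in blast)
  qed
  then show ?thesis by (simp add: topology_eq)
qed

section \<open>Path spaces of subgraphs and of finite graphs\<close>

lemma infinite_paths_subgraph:
  assumes "subgraph H E"
  shows "infinite_paths H \<subseteq> infinite_paths E"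
  using assms by (auto simp: subgraph_def compatible_def infinite_paths_def)

text \<open>Both topologies are inherited from the same sequence space, so cylinders of
  \<open>H\<close> and of \<open>E\<close> need not be compared.\<close>

lemma path_space_subgraph:
  assumes "subgraph H E"
  shows "path_space H = subtopology (path_space E) (infinite_paths H)"
proof -
  have "wf_digraph H" "wf_digraph E"
    using assms by (auto simp: subgraph_def)
  then show ?thesis
    using infinite_paths_subgraph[OF assms]
    by (simp add: path_space_eq_subtopology subtopology_subtopology Int_absorb1)
qed

text \<open>The paths form a closed subset of a product of finite sets, which is compact by
  Tychonoff's theorem.\<close>

lemma compactin_infinite_paths:
  assumes "wf_digraph H" "finite (arcs H)"
  shows "compactin (path_space H) (infinite_paths H)"
proof -
  let ?X = "infinite_paths H"
  have "compactin sequence_space (PiE UNIV (\<lambda>_. arcs H))"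
    using assms(2) by (simp add: compactin_PiE finite_imp_compactin)
  moreover have "?X \<subseteq> PiE UNIV (\<lambda>_. arcs H)"
    by (auto simp: infinite_paths_def)
  moreover have "closedin sequence_space ?X"
  proof -
    have "\<exists>k. \<forall>y. (\<forall>i<k. y i = x i) \<longrightarrow> y \<notin> ?X" if "x \<notin> ?X" for x
    proof -
      obtain n where n: "\<not> (x n \<in> arcs H \<and> tail H (x (Suc n)) = head H (x n))"
        using \<open>x \<notin> ?X\<close> by (auto simp: infinite_paths_def)
      \<comment> \<open>The violated condition at \<open>n\<close> involves the coordinates
        \<open>n\<close> and \<open>n + 1\<close>, hence the prefix length
        \<open>n + 2\<close>.\<close>
      have "y \<notin> ?X" if "\<forall>i<n + 2. y i = x i" for y
      proof
        assume "y \<in> ?X"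
        then have "y n \<in> arcs H \<and> tail H (y (Suc n)) = head H (y n)"
          by (simp add: infinite_paths_def)
        moreover have "y n = x n" "y (Suc n) = x (Suc n)"
          using that by auto
        ultimately show False using n by simp
      qed
      then show ?thesis by blast
    qed
    then have "openin sequence_space (UNIV - ?X)"
      unfolding openin_sequence_space by simp
    then show ?thesis by (simp add: closedin_def)
  qed
  ultimately have "compactin sequence_space ?X"
    by (rule closed_compactin)
  then show ?thesis
    by (simp add: path_space_eq_subtopology[OF assms(1)] compactin_subtopology)
qed

section \<open>The shift, compact sets of paths and extension of prefixes\<close>

lemma path_shift_infinite_paths: "path_shift ` infinite_paths E \<subseteq> infinite_paths E"
  by (auto simp: path_shift_def infinite_paths_def)

lemma funpow_path_shift: "(path_shift ^^ i) x = (\<lambda>n. x (n + i))"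
  by (induction i arbitrary: x) (simp_all add: path_shift_def)

text \<open>The image is a compact subset of a discrete space.\<close>

lemma finite_path_projection:
  assumes "wf_digraph E" "compactin (path_space E) K"
  shows "finite ((\<lambda>x. x j) ` K)"
proof -
  have "continuous_map sequence_space (discrete_topology UNIV) (\<lambda>x. x j)"
    by (rule continuous_map_product_projection) simp
  moreover have "compactin sequence_space K"
    using assms by (simp add: path_space_eq_subtopology compactin_subtopology)
  ultimately have "compactin (discrete_topology UNIV) ((\<lambda>x. x j) ` K)"
    by (intro image_compactin)
  then show ?thesis
    by (simp add: compactin_discrete_topology)
qed

text \<open>The analogue of a Lebesgue number: compactness turns the pointwise prefix lengths into a
  uniform one.\<close>

lemma lebesgue_number_path_space:
  assumes E: "wf_digraph E" and K: "compactin (path_space E) K" and \<alpha>: "open_cover (path_space E) K \<alpha>"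
  obtains k where "\<And>x. x \<in> K \<Longrightarrow> \<exists>A\<in>\<alpha>. \<forall>y\<in>infinite_paths E. (\<forall>i<k. y i = x i) \<longrightarrow> y \<in> A"
proof -
  let ?X = "infinite_paths E"
  have "\<exists>A\<in>\<alpha>. \<exists>k. \<forall>y\<in>?X. (\<forall>i<k. y i = x i) \<longrightarrow> y \<in> A" if x: "x \<in> K" for x
  proof -
    obtain A where "A \<in> \<alpha>" "x \<in> A" "openin (path_space E) A"
      using \<alpha> x unfolding open_cover_def by blast
    then show ?thesis unfolding openin_path_space[OF E] by blast
  qed
  then have "\<forall>x\<in>K. \<exists>p. fst p \<in> \<alpha> \<and> (\<forall>y\<in>?X. (\<forall>i<snd p. y i = x i) \<longrightarrow> y \<in> fst p)"
    unfolding split_paired_Ex fst_conv snd_conv by blast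
  from bchoice[OF this] obtain p where p:
    "\<forall>x\<in>K. fst (p x) \<in> \<alpha> \<and> (\<forall>y\<in>?X. (\<forall>i<snd (p x). y i = x i) \<longrightarrow> y \<in> fst (p x))" ..
  define A l where "A = (\<lambda>x. fst (p x))" and "l = (\<lambda>x. snd (p x))"
  have A: "\<And>x. x \<in> K \<Longrightarrow> A x \<in> \<alpha>"
    "\<And>x y. x \<in> K \<Longrightarrow> y \<in> ?X \<Longrightarrow> \<forall>i<l x. y i = x i \<Longrightarrow> y \<in> A x"
    using p unfolding A_def l_def by blast+
  define U where "U x = {y \<in> ?X. \<forall>i<l x. y i = x i}" for x
  have "openin (path_space E) (U x)" for x
    unfolding openin_path_space[OF E] U_def by (auto intro!: exI[of _ "l x"])
  moreover have "K \<subseteq> ?X"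
    using compactin_subset_topspace[OF K] topspace_path_space[OF E] by simp
  then have "K \<subseteq> (\<Union>x\<in>K. U x)"
    by (auto simp: U_def)
  ultimately obtain \<F> where \<F>: "finite \<F>" "\<F> \<subseteq> U ` K" "K \<subseteq> \<Union>\<F>"
    using compactinD[OF K, of "U ` K"] by blast
  then obtain D where D: "D \<subseteq> K" "finite D" "K \<subseteq> (\<Union>x\<in>D. U x)"
    using finite_subset_image[OF \<F>(1,2)] by blast
  show ?thesis
  proof (rule that)
    fix x assume "x \<in> K"
    then obtain d where d: "d \<in> D" "x \<in> U d"
      using D(3) by blast
    \<comment> \<open>The sum is a convenient common bound for the finitely many lengths. If
      \<open>y\<close> agrees with \<open>x\<close> that far, it agrees with \<open>d\<close> up to
      \<open>l d\<close>.\<close>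
    have "l d \<le> sum l D"
      by (rule member_le_sum) (use d D in auto)
    then have "y \<in> A d" if "y \<in> ?X" "\<forall>i<sum l D. y i = x i" for y
      using that d D(1) by (intro A(2)) (auto simp: U_def)
    then show "\<exists>A\<in>\<alpha>. \<forall>y\<in>?X. (\<forall>i<sum l D. y i = x i) \<longrightarrow> y \<in> A"
      using A(1) D(1) d(1) by blast
  qed
qed

text \<open>Two of the last \<open>card (arcs H) + 1\<close> positions below \<open>m\<close> carry
  the same arc, and the segment between them is a cycle. Here \<open>x\<close> stands for a finite
  path of length \<open>m\<close>; its later values are arbitrary.\<close>

lemma path_prefix_extends:
  fixes x :: "nat \<Rightarrow> 'e" and H :: "('v, 'e) pre_digraph"
  assumes fin: "finite (arcs H)" and arcs: "\<And>i. i < m \<Longrightarrow> x i \<in> arcs H"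
    and walk: "\<And>i. Suc i < m \<Longrightarrow> tail H (x (Suc i)) = head H (x i)"
    and m: "card (arcs H) < m"
  obtains y where "y \<in> infinite_paths H" "\<And>i. i + card (arcs H) < m \<Longrightarrow> y i = x i"
proof -
  let ?M = "card (arcs H)"
  let ?I = "{m - Suc ?M..<m}"
  have "x ` ?I \<subseteq> arcs H" using arcs by auto
  then have "card (x ` ?I) \<le> ?M" using fin card_mono by blast
  moreover have "card ?I = Suc ?M" using m by simp
  ultimately have "\<not> inj_on x ?I"
    using card_image[of x ?I] by linarith
  then obtain a b where ab: "a \<in> ?I" "b \<in> ?I" "a \<noteq> b" "x a = x b"
    by (auto simp: inj_on_def)
  define p q where "p = min a b" and "q = max a b"
  have pq: "m - Suc ?M \<le> p" "p < q" "q < m" "x p = x q"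
    using ab by (auto simp: p_def q_def min_def max_def)
  \<comment> \<open>\<open>y\<close> runs through the cycle from \<open>p\<close> to \<open>q\<close> forever\<close>
  define d where "d = q - p"
  define y where "y t = (if t < p then x t else x (p + (t - p) mod d))" for t
  have d: "0 < d" using pq by (simp add: d_def)
  have in_range: "p + t mod d < q" for t
    using mod_less_divisor[OF d, of t] pq(2) unfolding d_def by linarith
  show ?thesis
  proof
    show "y \<in> infinite_paths H"
      unfolding infinite_paths_def
    proof (intro CollectI allI conjI)
      fix t
      show "y t \<in> arcs H"
        using arcs in_range pq(2,3) by (auto simp: y_def intro: less_trans)
      consider "Suc t < p" | "Suc t = p" | "p \<le> t" by linarith
      then show "tail H (y (Suc t)) = head H (y t)"
      proof cases
        case 1
        then show ?thesis using walk[of t] pq by (simp add: y_def)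
      next
        case 2
        then show ?thesis using walk[of t] pq by (auto simp: y_def)
      next
        case 3
        let ?r = "(t - p) mod d"
        \<comment> \<open>Where the cycle closes, \<open>y\<close> jumps back to \<open>p\<close>;
          as \<open>x p = x q\<close>, the next arc is still the successor along
          \<open>x\<close>.\<close>
        have "y (Suc t) = x (Suc (p + ?r))"
        proof (cases "Suc ?r = d")
          case True
          then have "y (Suc t) = x p"
            using 3 by (simp add: y_def Suc_diff_le mod_Suc)
          also have "x p = x (Suc (p + ?r))"
          proof -
            have "Suc (p + ?r) = q"
              using True pq(2) unfolding d_def by linarith
            then show ?thesis using pq(4) by simp
          qed
          finally show ?thesis .
        next
          case False
          then show ?thesis
            using 3 by (simp add: y_def Suc_diff_le mod_Suc)
        qed
        moreover have "y t = x (p + ?r)"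
          using 3 by (simp add: y_def)
        ultimately show ?thesis
          using walk[of "p + ?r"] in_range[of "t - p"] pq by simp
      qed
    qed
    fix i assume "i + ?M < m"
    \<comment> \<open>The case \<open>i = p\<close> is included, because the cycle starts with
      \<open>x p\<close> itself.\<close>
    then have "i \<le> p" using pq(1) by linarith
    then show "y i = x i" by (auto simp: y_def)
  qed
qed

section \<open>Approximation by finite subgraphs\<close>

text \<open>The vertices are the endpoints of the arcs, as well-formedness requires. Sinks may
  occur, which is why finite paths need not extend.\<close>

abbreviation arc_subgraph :: "('v, 'e) pre_digraph \<Rightarrow> 'e set \<Rightarrow> ('v, 'e) pre_digraph" where
  "arc_subgraph E F \<equiv>
    \<lparr>verts = tail E ` F \<union> head E ` F, arcs = F, tail = tail E, head = head E\<rparr>"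

lemma arc_subgraph:
  assumes "wf_digraph E" "F \<subseteq> arcs E"
  shows "subgraph (arc_subgraph E F) E" "finite F \<Longrightarrow> fin_digraph (arc_subgraph E F)"
proof -
  interpret wf_digraph E by fact
  have wf: "wf_digraph (arc_subgraph E F)" by unfold_locales auto
  then show "subgraph (arc_subgraph E F) E"
    using assms by (auto simp: subgraph_def compatible_def)
  show "fin_digraph (arc_subgraph E F)" if "finite F"
    using wf that by (intro wf_digraph.fin_digraphI) auto
qed

lemma orbit_part_infinite_paths:
  assumes "wf_digraph H"
  shows "orbit_part (path_space H) path_shift (infinite_paths H) n = infinite_paths H"
  using funpow_in_topspace[of path_shift "path_space H"] path_shift_infinite_paths[of H]
  by (auto simp: orbit_part_def iter_preimage_def topspace_path_space[OF assms])

lemma entropy_cover_le_finite_subgraph: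
  fixes E :: "('v, 'e) pre_digraph"
  assumes E: "wf_digraph E" and K: "compactin (path_space E) K" and \<alpha>: "open_cover (path_space E) K \<alpha>"
  obtains H where "subgraph H E" "fin_digraph H"
    "entropy_cover (path_space E) path_shift K \<alpha> \<le> top_entropy (path_space H) path_shift"
proof -
  let ?X = "infinite_paths E"
  obtain k where k: "\<And>x. x \<in> K \<Longrightarrow> \<exists>A\<in>\<alpha>. \<forall>y\<in>?X. (\<forall>i<k. y i = x i) \<longrightarrow> y \<in> A"
    using lebesgue_number_path_space[OF E K \<alpha>] by blast
  then obtain A where A: "\<And>x. x \<in> K \<Longrightarrow> A x \<in> \<alpha>"
    "\<And>x y. x \<in> K \<Longrightarrow> y \<in> ?X \<Longrightarrow> \<forall>i<k. y i = x i \<Longrightarrow> y \<in> A x"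
    by metis
  have KX: "K \<subseteq> ?X"
    using compactin_subset_topspace[OF K] topspace_path_space[OF E] by simp
  \<comment> \<open>For \<open>x\<close> in \<open>K_n\<close> the shifts of \<open>x\<close> up to
    time \<open>n\<close> lie in \<open>K\<close>, so the arcs of \<open>x\<close> at positions up
    to \<open>n + k\<close> lie in \<open>F\<close>. Position 0 is included even if
    \<open>k = 0\<close>.\<close>
  define F where "F = (\<Union>j\<le>k. (\<lambda>x. x j) ` K)"
  have F: "finite F" "F \<subseteq> arcs E"
    using finite_path_projection[OF E K] KX by (auto simp: F_def infinite_paths_def)
  define H where "H = arc_subgraph E F"
  have H: "subgraph H E" "fin_digraph H" "wf_digraph H" "arcs H = F"
    using arc_subgraph[OF E F(2)] F(1) by (auto simp: H_def subgraph_def)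
  let ?Y = "infinite_paths H"
  \<comment> \<open>A generating cover: a member of its \<open>n\<close>-th refinement fixes the
    coordinates \<open>0..n\<close>.\<close>
  define \<gamma> where "\<gamma> = (\<lambda>e. {y \<in> ?Y. y 0 = e}) ` F"
  have \<gamma>: "open_cover (path_space H) ?Y \<gamma>"
    using H(4) by (auto simp: open_cover_def \<gamma>_def openin_path_space[OF H(3)] infinite_paths_def
        intro!: exI[of _ 1])
  have cY: "compactin (path_space H) ?Y"
    using compactin_infinite_paths[OF H(3)] H(4) F(1) by simp
  let ?M = "card F"
  \<comment> \<open>the \<open>Suc\<close> keeps \<open>C\<close> positive when \<open>F\<close> is empty\<close>
  define C where "C = Suc (card F ^ (?M + k))"
  \<comment> \<open>The condition \<open>?M \<le> n\<close> supplies the length required by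
    \<open>path_prefix_extends\<close> and makes \<open>n - ?M\<close> a true subtraction.\<close>
  have "cover_number (refined_cover (path_space E) path_shift \<alpha> n) (orbit_part (path_space E) path_shift K n)
      \<le> enat C * cover_number (refined_cover (path_space H) path_shift \<gamma> n)
          (orbit_part (path_space H) path_shift ?Y n)"
    (is "cover_number ?\<alpha>n ?Kn \<le> enat C * cover_number ?\<gamma>n _") if n: "?M \<le> n" for n
  proof (cases "cover_number ?\<gamma>n ?Y")
    case infinity
    then show ?thesis by (simp add: orbit_part_infinite_paths[OF H(3)] C_def)
  next
    case (enat c)
    have "1 \<le> c"
      using one_le_cover_number[of ?\<gamma>n ?Y] by (simp add: enat one_enat_def)
    then have Cc: "1 \<le> C * c" by (simp add: C_def)
    have Kn: "x \<in> ?X" "\<And>i. i \<le> n \<Longrightarrow> (\<lambda>t. x (t + i)) \<in> K" if "x \<in> ?Kn" for x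
      using that by (auto simp: orbit_part_def iter_preimage_def funpow_path_shift topspace_path_space[OF E])
    have "\<exists>y\<in>?Y. \<forall>i. i + ?M \<le> n \<longrightarrow> y i = x i" if x: "x \<in> ?Kn" for x
    proof -
      have "x i \<in> arcs H" if "i < Suc n" for i
      proof -
        have "(\<lambda>z. z 0) (\<lambda>t. x (t + i)) \<in> (\<lambda>z. z 0) ` K"
          using Kn(2)[OF x, of i] that by (intro imageI) simp
        then show ?thesis by (auto simp: H(4) F_def)
      qed
      moreover have "tail H (x (Suc i)) = head H (x i)" for i
        using Kn(1)[OF x] by (simp add: H_def infinite_paths_def)
      ultimately obtain y where "y \<in> ?Y" "\<And>i. i + card (arcs H) < Suc n \<Longrightarrow> y i = x i"
        using path_prefix_extends[of H "Suc n" x] F(1) H(4) n by auto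
      then show ?thesis by (auto simp: H(4) less_Suc_eq_le)
    qed
    then obtain y where y: "\<And>x. x \<in> ?Kn \<Longrightarrow> y x \<in> ?Y"
      "\<And>x i. x \<in> ?Kn \<Longrightarrow> i + ?M \<le> n \<Longrightarrow> y x i = x i"
      by metis
    have "cover_number ?\<alpha>n ?Kn \<le> enat (C * c)"
    proof (cases "?Kn = {}")
      case True
      then show ?thesis using Cc by (intro cover_number_leI) auto
    next
      case False
      then have "?Y \<noteq> {}" using y(1) by blast
      then obtain \<beta> where \<beta>: "\<beta> \<subseteq> ?\<gamma>n" "finite \<beta>" "?Y \<subseteq> \<Union>\<beta>" "card \<beta> \<le> c"
        using cover_number_leE[of ?\<gamma>n ?Y c] enat by auto
      then have "\<forall>z\<in>?Y. \<exists>D. D \<in> \<beta> \<and> z \<in> D" by blast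
      from bchoice[OF this] obtain B where
        B: "\<And>z. z \<in> ?Y \<Longrightarrow> B z \<in> \<beta>" "\<And>z. z \<in> ?Y \<Longrightarrow> z \<in> B z"
        by blast
      \<comment> \<open>Coordinate \<open>i\<close> of a path is the first arc of its
        \<open>i\<close>-th shift, which the refinement fixes at time \<open>i\<close>.\<close>
      have \<gamma>n: "z i = z' i" if D: "D \<in> \<beta>" "z \<in> D" "z' \<in> D" "i \<le> n" for z z' D i
      proof -
        have "D \<in> ?\<gamma>n" using D(1) \<beta>(1) by blast
        then obtain f where f: "D = (\<Inter>i\<le>n. iter_preimage (path_space H) path_shift i (f i))"
          "\<forall>i\<le>n. f i \<in> \<gamma>"
          using \<gamma> by (subst (asm) refined_cover_eq) (auto simp: open_cover_def openin_subset)
        obtain e where "f i = {y \<in> ?Y. y 0 = e}"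
          using f(2) D(4) by (auto simp: \<gamma>_def)
        moreover have "(path_shift ^^ i) z \<in> f i" "(path_shift ^^ i) z' \<in> f i"
          using D(2-4) by (auto simp: f(1) iter_preimage_def)
        ultimately show ?thesis
          by (simp add: funpow_path_shift)
      qed
      let ?S = "\<beta> \<times> PiE {..<?M + k} (\<lambda>_. F)"
      define \<Phi> where "\<Phi> x = (B (y x), restrict (\<lambda>j. x (n - ?M + j)) {..<?M + k})" for x
      \<comment> \<open>\<open>\<Phi> x\<close> determines \<open>x\<close> on \<open>{..<n + k}\<close>: the member of \<open>\<beta>\<close> gives the coordinates up to
        \<open>n - ?M\<close>, and the rest is recorded verbatim\<close>
      have \<Phi>: "x' i = x i" if "x \<in> ?Kn" "x' \<in> ?Kn" "\<Phi> x' = \<Phi> x" "i < n + k" for x x' i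
      proof (cases "i + ?M \<le> n")
        case True
        have "B (y x') = B (y x)" using that(3) by (simp add: \<Phi>_def)
        then have "y x' i = y x i"
          using B(1)[OF y(1)[OF that(1)]] B(2)[OF y(1)[OF that(1)]] B(2)[OF y(1)[OF that(2)]] True
          by (intro \<gamma>n[of "B (y x)"]) simp_all
        then show ?thesis using y(2) that(1,2) True by simp
      next
        case False
        then have i: "i = n - ?M + (i - (n - ?M))" "i - (n - ?M) < ?M + k"
          using n that(4) by linarith+
        have "restrict (\<lambda>j. x' (n - ?M + j)) {..<?M + k} = restrict (\<lambda>j. x (n - ?M + j)) {..<?M + k}"
          using that(3) by (simp add: \<Phi>_def)
        from fun_cong[OF this, of "i - (n - ?M)"] i show ?thesis by simp
      qed
      show ?thesis
      proof (rule cover_number_le_classes[of ?S _ \<Phi>])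
        show "finite ?S" using \<beta>(2) F(1) by (simp add: finite_PiE)
        have "card ?S \<le> c * card F ^ (?M + k)"
          using \<beta>(4) by (simp add: card_cartesian_product card_PiE)
        then show "card ?S \<le> C * c" by (simp add: C_def algebra_simps)
        fix x assume x: "x \<in> ?Kn"
        have "x (n - ?M + j) \<in> F" if "j < ?M + k" for j
        proof -
          define t where "t = n - ?M + j"
          have "t < n + k" using n that by (simp add: t_def)
          \<comment> \<open>Position \<open>t\<close> of \<open>x\<close> is read as position
            \<open>t - min t n\<close> of the shift by \<open>min t n\<close>, a time at which the
            orbit is still in \<open>K\<close>.\<close>
          then have le: "t - min t n \<le> k" "t = t - min t n + min t n" by auto
          have "(\<lambda>z. z (t - min t n)) (\<lambda>s. x (s + min t n)) \<in> (\<lambda>z. z (t - min t n)) ` K"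
            using Kn(2)[OF x, of "min t n"] by (intro imageI) simp
          then have "x t \<in> F"
            using le unfolding F_def by auto
          then show ?thesis by (simp add: t_def)
        qed
        then show "\<Phi> x \<in> ?S"
          using B(1) y(1)[OF x] by (auto simp: \<Phi>_def)
        \<comment> \<open>At time \<open>i\<close> the member chosen for the \<open>i\<close>-th
          shift of \<open>x\<close> is used. Equal \<Phi>-values mean agreement on
          \<open>n + k\<close> coordinates, so the \<open>i\<close>-th shifts agree on their first
          \<open>k\<close>.\<close>
        let ?A = "\<Inter>i\<le>n. iter_preimage (path_space E) path_shift i (A (\<lambda>t. x (t + i)))"
        have "?A \<in> ?\<alpha>n"
          using A(1) Kn(2)[OF x] \<alpha>
          by (subst refined_cover_eq)
            (auto simp: open_cover_def openin_subset intro!: exI[of _ "\<lambda>i. A (\<lambda>t. x (t + i))"])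
        moreover have "x' \<in> ?A" if x': "x' \<in> ?Kn" "\<Phi> x' = \<Phi> x" for x'
        proof -
          have "(\<lambda>t. x' (t + i)) \<in> A (\<lambda>t. x (t + i))" if "i \<le> n" for i
            using Kn(2)[OF x that] Kn(2)[OF x'(1) that] KX \<Phi>[OF x x'] that by (intro A(2)) auto
          then show ?thesis
            using Kn(1)[OF x'(1)]
            by (auto simp: iter_preimage_def funpow_path_shift topspace_path_space[OF E])
        qed
        ultimately show "\<exists>D\<in>?\<alpha>n. \<forall>x'\<in>?Kn. \<Phi> x' = \<Phi> x \<longrightarrow> x' \<in> D" by blast
      qed (rule Cc)
    qed
    then show ?thesis by (simp add: orbit_part_infinite_paths[OF H(3)] enat)
  qed
  then have "entropy_cover (path_space E) path_shift K \<alpha> \<le> entropy_cover (path_space H) path_shift ?Y \<gamma>"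
    using K \<alpha> cY \<gamma> path_shift_infinite_paths
    by (intro entropy_cover_le[where C = C] eventually_sequentiallyI[of ?M])
      (simp_all add: topspace_path_space E H(3))
  also have "\<dots> \<le> entropy_compact (path_space H) path_shift ?Y"
    unfolding entropy_compact_def using \<gamma> by (intro SUP_upper) simp
  also have "\<dots> \<le> top_entropy (path_space H) path_shift"
    unfolding top_entropy_def using cY by (intro SUP_upper) simp
  finally show ?thesis using that H(1,2) by blast
qed

theorem theorem7p21:
  fixes E :: "('v, 'e) pre_digraph"
  assumes "wf_digraph E"
    and "countable (verts E)"
    and "countable (arcs E)"
    and "row_finite E"
    and "no_sinks E"
  shows "top_entropy (path_space E) path_shift =
    (SUP H \<in> {H. subgraph H E \<and> fin_digraph H}. top_entropy (path_space H) path_shift)"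
proof (rule antisym)
  \<comment> \<open>The subgraph depends on both \<open>K\<close> and \<alpha>, so the bound is
    proved for each pair before suprema are taken.\<close>
  have "entropy_cover (path_space E) path_shift K \<alpha> \<le>
      (SUP H \<in> {H. subgraph H E \<and> fin_digraph H}. top_entropy (path_space H) path_shift)"
    if K: "compactin (path_space E) K" and \<alpha>: "open_cover (path_space E) K \<alpha>" for K \<alpha>
  proof -
    obtain H where H: "subgraph H E" "fin_digraph H"
      "entropy_cover (path_space E) path_shift K \<alpha> \<le> top_entropy (path_space H) path_shift"
      using entropy_cover_le_finite_subgraph[OF assms(1) K \<alpha>] .
    from H(3) show ?thesis
      by (rule order_trans) (use H(1,2) in \<open>auto intro: SUP_upper\<close>)
  qed
  then show "top_entropy (path_space E) path_shift \<le>
      (SUP H \<in> {H. subgraph H E \<and> fin_digraph H}. top_entropy (path_space H) path_shift)"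
    unfolding top_entropy_def[of "path_space E"] entropy_compact_def by (auto intro!: SUP_least)
  have "top_entropy (path_space H) path_shift \<le> top_entropy (path_space E) path_shift"
    if "subgraph H E" for H
    unfolding path_space_subgraph[OF that]
    using path_shift_infinite_paths infinite_paths_subgraph[OF that]
    by (intro top_entropy_subtopology_le) (simp_all add: topspace_path_space[OF assms(1)])
  then show "(SUP H \<in> {H. subgraph H E \<and> fin_digraph H}. top_entropy (path_space H) path_shift)
      \<le> top_entropy (path_space E) path_shift"
    by (auto intro!: SUP_least)
qed

end
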